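(* Let $O\subset\mathbb{R}^n$ be an open convex subset with coordinates $(u_1,\dots,u_n)$. Any two points $P^0=(p^0_1,\dots,p^0_n)$ and $P^1=(p^1_1,\dots,p^1_n)$ in $O$ uniquely determine an $n$-rectangle in $O$ (possibly degenerate). Now consider a map $\mathbf{x}:O\to\mathbf{x}(O)$. The map $\mathbf{x}$ has an orthogonal Liouville line element $$ds^2=\sum_{k=1}^n\left(\sum_{i=1}^n U_{ik}(u_i)\right)du_k^2,$$ where each $U_{ik}$ is a function of the single variable $u_i$, if and only if, for all points $P^0,P^1\in O$ (with no restriction on their choice in $O$), the images under $\mathbf{x}$ of the diagonals of the $n$-rectangle determined by $P^0$ and $P^1$ have the same energy.
   Context: The map $\mathbf{x}$ is a sufficiently differentiable map into a Euclidean space $\mathbb{R}^N$. Its line element is $ds^2=\sum_{j,k=1}^n g_{jk}\,du_j\,du_k$ with $g_{jk}=\partial_{u_j}\mathbf{x}\cdot\partial_{u_k}\mathbf{x}$ (Euclidean scalar product). Having an orthogonal Liouville line element thus means that on $O$ one has $g_{jk}=0$ for $j\ne k$ and $g_{kk}(u_1,\dots,u_n)=\sum_{i=1}^n U_{ik}(u_i)$. The $n$-rectangle determined by $P^0,P^1$ is the axis-parallel box $\prod_{k=1}^n[\min(p^0_k,p^1_k),\max(p^0_k,p^1_k)]$, which has $P^0$ and $P^1$ as opposite vertices; it is degenerate if $p^0_k=p^1_k$ for some $k$. With center $M=\tfrac12(P^0+P^1)$ and $\delta=\tfrac12(P^1-P^0)=(\delta_1,\dots,\delta_n)$, its diagonals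 are the straight segments joining opposite vertices, parametrized affinely as $d_\sigma(t)=M+t(\sigma_1\delta_1,\dots,\sigma_n\delta_n)$, $t\in[-1,1]$, for sign vectors $\sigma\in\{-1,1\}^n$ ($\sigma$ and $-\sigma$ give the same diagonal traversed in opposite directions). The energy of a curve $p:[a,b]\to\mathbb{R}^N$ is $E(p)=\int_a^b|\dot p(t)|^2\,dt$. The image of a diagonal $d_\sigma$ is the curve $\mathbf{x}\circ d_\sigma$ on $[-1,1]$, so equality of the energies means $E(\mathbf{x}\circ d_\sigma)=E(\mathbf{x}\circ d_\tau)$ for all $\sigma,\tau\in\{-1,1\}^n$.
   Formalization: The points P^0, P^1 range over pairs in O whose n-rectangle lies in O: for a general open convex O (e.g. a disc) the rectangle may leave O, where x is undefined. The map x is taken to be C^3. *)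

theory Defs
  imports "HOL-Analysis.Analysis"
begin

definition partial_deriv :: "'n \<Rightarrow> (real^'n \<Rightarrow> 'b::real_normed_vector) \<Rightarrow> real^'n \<Rightarrow> 'b" where
  "partial_deriv k f u = frechet_derivative f (at u) (axis k 1)"

text \<open>\<open>C_k_on r f S\<close>, intended for open \<open>S\<close>, says that \<open>f\<close> is \<open>r\<close> times continuously
  differentiable on \<open>S\<close>.\<close>

primrec C_k_on :: "nat \<Rightarrow> (real^'n \<Rightarrow> 'b::real_normed_vector) \<Rightarrow> (real^'n) set \<Rightarrow> bool" where
  "C_k_on 0 f S \<longleftrightarrow> continuous_on S f"
| "C_k_on (Suc r) f S \<longleftrightarrow>
     (\<forall>u\<in>S. f differentiable (at u)) \<and> (\<forall>k. C_k_on r (partial_deriv k f) S)"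

definition metric_coeff :: "(real^'n \<Rightarrow> real^'m) \<Rightarrow> 'n \<Rightarrow> 'n \<Rightarrow> real^'n \<Rightarrow> real" where
  "metric_coeff x j k u = partial_deriv j x u \<bullet> partial_deriv k x u"

definition orthogonal_Liouville_on :: "(real^'n) set \<Rightarrow> (real^'n \<Rightarrow> real^'m) \<Rightarrow> bool" where
  "orthogonal_Liouville_on D x \<longleftrightarrow>
     (\<exists>U :: 'n \<Rightarrow> 'n \<Rightarrow> real \<Rightarrow> real. \<forall>u\<in>D.
        (\<forall>j k. j \<noteq> k \<longrightarrow> metric_coeff x j k u = 0) \<and>
        (\<forall>k. metric_coeff x k k u = (\<Sum>i\<in>UNIV. U i k (u $ i))))"

definition n_rectangle :: "real^'n \<Rightarrow> real^'n \<Rightarrow> (real^'n) set" where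
  "n_rectangle P0 P1 = cbox (\<chi> k. min (P0 $ k) (P1 $ k)) (\<chi> k. max (P0 $ k) (P1 $ k))"

definition sign_vectors :: "(real^'n) set" where
  "sign_vectors = {\<sigma>. \<forall>k. \<sigma> $ k \<in> {-1, 1}}"

definition diagonal :: "real^'n \<Rightarrow> real^'n \<Rightarrow> real^'n \<Rightarrow> real \<Rightarrow> real^'n" where
  "diagonal P0 P1 \<sigma> t =
     (let M = (1/2) *\<^sub>R (P0 + P1); \<delta> = (1/2) *\<^sub>R (P1 - P0)
      in M + t *\<^sub>R (\<chi> k. \<sigma> $ k * \<delta> $ k))"

definition energy :: "(real \<Rightarrow> 'b::real_normed_vector) \<Rightarrow> real \<Rightarrow> real \<Rightarrow> real" where
  "energy p a b = integral {a..b} (\<lambda>t. (norm (vector_derivative p (at t within {a..b})))\<^sup>2)"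

text \<open>The points range over all pairs whose rectangle lies in \<open>D\<close>. For a convex \<open>D\<close> that is not
  itself a box, the rectangle of two points of \<open>D\<close> may leave \<open>D\<close>; its diagonals then leave \<open>D\<close> as
  well and have no image under a map defined on \<open>D\<close> only. If \<open>D\<close> contains the rectangle of any two
  of its points, the inclusion is automatic.\<close>

definition equal_diagonal_energies_on :: "(real^'n) set \<Rightarrow> (real^'n \<Rightarrow> real^'m) \<Rightarrow> bool" where
  "equal_diagonal_energies_on D x \<longleftrightarrow>
     (\<forall>P0\<in>D. \<forall>P1\<in>D. n_rectangle P0 P1 \<subseteq> D \<longrightarrow>
        (\<forall>\<sigma>\<in>sign_vectors. \<forall>\<tau>\<in>sign_vectors.
           energy (x \<circ> diagonal P0 P1 \<sigma>) (-1) 1 = energy (x \<circ> diagonal P0 P1 \<tau>) (-1) 1))"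

end

theory Submission
  imports Defs
begin

text \<open>
  Let \<open>q(u, v)\<close> be the squared length of the differential of \<open>x\<close> at \<open>u\<close> applied to \<open>v\<close>. Shrinking a
  rectangle towards its centre \<open>M\<close> by a factor \<open>s\<close> and differentiating the energies in \<open>s\<close> shows that
  equality of the energies means that \<open>q(M + w, w) + q(M - w, w)\<close> does not change under sign flips of
  the components of \<open>w\<close>. Letting \<open>w = h (e\<^sub>j \<plusminus> e\<^sub>k)\<close> tend to 0 gives \<open>g\<^sub>j\<^sub>k = 0\<close>. Then
  \<open>w = a e\<^sub>i + b e\<^sub>j + c e\<^sub>k\<close> gives that all mixed second differences of the \<open>g\<^sub>k\<^sub>k\<close> vanish on
  every box in \<open>D\<close>, so \<open>\<partial>\<^sub>i g\<^sub>k\<^sub>k\<close> depends only on \<open>u\<^sub>i\<close>: locally at first, and on \<open>D\<close> because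
  the slices of constant \<open>u\<^sub>i\<close> are connected. Integrating the gradient along segments from a fixed point
  separates the variables. Conversely, if the metric is Liouville, a sign flip of \<open>w\<^sub>i\<close> only exchanges
  \<open>U\<^sub>i\<^sub>k (M\<^sub>i + t w\<^sub>i)\<close> and \<open>U\<^sub>i\<^sub>k (M\<^sub>i - t w\<^sub>i)\<close>, whose sum enters the energy.
\<close>

section \<open>Calculus along lines and on symmetric intervals\<close>

lemma frechet_derivative_eq_sum_partial:
  fixes f :: "real^'n \<Rightarrow> 'b::real_normed_vector"
  assumes "f differentiable (at u)"
  shows "frechet_derivative f (at u) v = (\<Sum>k\<in>UNIV. v $ k *\<^sub>R partial_deriv k f u)"
proof -
  interpret linear "frechet_derivative f (at u)"
    using assms by (rule linear_frechet_derivative)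
  have "v = (\<Sum>k\<in>UNIV. v $ k *\<^sub>R axis k 1)"
    by (simp add: vec_eq_iff axis_def if_distrib cong: if_cong)
  then have "frechet_derivative f (at u) v
      = frechet_derivative f (at u) (\<Sum>k\<in>UNIV. v $ k *\<^sub>R axis k 1)"
    by simp
  then show ?thesis
    by (simp add: sum scale partial_deriv_def)
qed

lemma has_vector_derivative_along_line:
  fixes f :: "real^'n \<Rightarrow> 'b::real_normed_vector"
  assumes "f differentiable (at (p + t *\<^sub>R v))"
  shows "((\<lambda>s. f (p + s *\<^sub>R v)) has_vector_derivative
           (\<Sum>k\<in>UNIV. v $ k *\<^sub>R partial_deriv k f (p + t *\<^sub>R v))) (at t)"
proof -
  have "(f has_derivative frechet_derivative f (at (p + t *\<^sub>R v))) (at (p + t *\<^sub>R v))"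
    using assms frechet_derivative_works by blast
  moreover have "((\<lambda>s. p + s *\<^sub>R v) has_vector_derivative v) (at t)"
    by (auto intro!: derivative_eq_intros)
  ultimately have "(f \<circ> (\<lambda>s. p + s *\<^sub>R v) has_vector_derivative
      frechet_derivative f (at (p + t *\<^sub>R v)) v) (at t)"
    by (intro vector_derivative_diff_chain_within)
       (auto simp: has_derivative_at_withinI)
  then show ?thesis
    by (simp add: o_def frechet_derivative_eq_sum_partial[OF assms])
qed

lemma partial_deriv_eqI:
  fixes f :: "real^'n \<Rightarrow> 'b::real_normed_vector"
  assumes "(f has_derivative f') (at u)"
  shows "partial_deriv k f u = f' (axis k 1)"
  using frechet_derivative_at[OF assms] by (simp add: partial_deriv_def)

text \<open>Substituting \<open>s * t\<close> turns the hypothesis into vanishing integrals over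
  \<open>{-s..s}\<close>, and evenness passes this on to \<open>{0..s}\<close>. The primitive of
  \<open>K\<close> is therefore 0 on \<open>{0..1}\<close>, while its one-sided derivative at 1 is
  \<open>K 1\<close>. This converts energy identities for all shrunken rectangles into a pointwise
  identity at the vertices.\<close>

lemma even_eq_0_if_integrals_eq_0:
  fixes K :: "real \<Rightarrow> real"
  assumes cont: "continuous_on {-1..1} K"
    and even: "\<And>t. K (- t) = K t"
    and int: "\<And>s. 0 < s \<Longrightarrow> s \<le> 1 \<Longrightarrow> integral {-1..1} (\<lambda>t. K (s * t)) = 0"
  shows "K 1 = 0"
proof -
  have zero: "integral {0..s} K = 0" if "s \<in> {0..1}" for s
  proof (cases "s = 0")
    case False
    with that have s: "0 < s" "s \<le> 1" by auto
    have img: "(\<lambda>t. t / s) ` {-s..s} = {-1..1}"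
      using s by (simp add: image_divide_atLeastAtMost)
    have "integral {-s..s} K = 0"
      using integral_stretch_real[of s "-s" s K] int[OF s] s by (simp add: img)
    moreover have "integral {-s..0} K + integral {0..s} K = integral {-s..s} K"
      using s by (intro Henstock_Kurzweil_Integration.integral_combine integrable_continuous_real
          continuous_on_subset[OF cont]) auto
    moreover have "integral {-s..0} K = integral {0..s} K"
      using Henstock_Kurzweil_Integration.integral_reflect_real[of s 0 K] by (simp add: even)
    ultimately show ?thesis by simp
  qed auto
  have cont01: "continuous_on {0..1} K"
    using cont by (rule continuous_on_subset) auto
  have D1: "((\<lambda>s. integral {0..s} K) has_vector_derivative K 1) (at 1 within cbox 0 1)"
    using integral_has_vector_derivative[OF cont01, of 1] by simp
  have D2: "((\<lambda>s. integral {0..s} K) has_vector_derivative 0) (at 1 within cbox 0 1)"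
    by (rule has_vector_derivative_transform[where f = "\<lambda>_. 0"]) (auto simp: zero)
  show ?thesis
    using vector_derivative_unique_within_closed_interval[OF _ _ D1 D2] by auto
qed

lemma integral_symmetric_interval:
  fixes h :: "real \<Rightarrow> real"
  assumes "continuous_on {-1..1} h"
  shows "integral {-1..1} (\<lambda>t. h t + h (- t)) = 2 * integral {-1..1} h"
proof -
  have "continuous_on {-1..1} (\<lambda>t. h (- t))"
    by (rule continuous_on_compose2[OF assms]) (auto intro!: continuous_intros)
  then have "integral {-1..1} (\<lambda>t. h t + h (- t))
      = integral {-1..1} h + integral {-1..1} (\<lambda>t. h (- t))"
    by (intro integral_add integrable_continuous_real assms)
  then show ?thesis
    using Henstock_Kurzweil_Integration.integral_reflect_real[of 1 "-1" h] by simp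
qed

section \<open>Rectangles in centred form\<close>

text \<open>Only the absolute values of the components of \<open>w\<close> matter, so all sign flips
  of \<open>w\<close> are half-diagonals of one and the same rectangle.\<close>

lemma n_rectangle_sym_iff:
  "p \<in> n_rectangle (M - w) (M + w) \<longleftrightarrow> (\<forall>k. \<bar>p $ k - M $ k\<bar> \<le> \<bar>w $ k\<bar>)"
  unfolding n_rectangle_def mem_box_cart
  by (auto simp: min_def max_def abs_if split: if_splits) (smt (verit))+

text \<open>This is how the proviso on rectangles in \<open>equal_diagonal_energies_on\<close> is
  met when \<open>D\<close> itself is not a box.\<close>

lemma n_rectangle_subset_box:
  assumes "P \<in> box a b" "Q \<in> box a b"
  shows "n_rectangle P Q \<subseteq> box a b"
proof
  fix p assume "p \<in> n_rectangle P Q"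
  then have "min (P $ k) (Q $ k) \<le> p $ k" "p $ k \<le> max (P $ k) (Q $ k)" for k
    by (auto simp: n_rectangle_def mem_box_cart)
  moreover have "a $ k < P $ k" "P $ k < b $ k" "a $ k < Q $ k" "Q $ k < b $ k" for k
    using assms by (auto simp: mem_box_cart)
  ultimately show "p \<in> box a b"
    unfolding mem_box_cart by (smt (verit, ccfv_SIG) max_def min_def)
qed

section \<open>The metric as a quadratic form, and the energy of a diagonal\<close>

locale C2_map =
  fixes D :: "(real^'n) set" and x :: "real^'n \<Rightarrow> real^'m"
  assumes open_D: "open D" and convex_D: "convex D" and C2: "C_k_on 2 x D"
begin

lemma differentiable: "u \<in> D \<Longrightarrow> x differentiable (at u)"
  and partial_differentiable: "u \<in> D \<Longrightarrow> partial_deriv k x differentiable (at u)"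
  and continuous_second_partial: "continuous_on D (partial_deriv i (partial_deriv k x))"
  using C2 by (auto simp: numeral_2_eq_2)

lemma continuous_partial: "continuous_on D (partial_deriv k x)"
  by (meson partial_differentiable continuous_at_imp_continuous_on differentiable_imp_continuous_within)

text \<open>The differential of \<open>x\<close> for \<open>u\<close> in \<open>D\<close>, written
  through the partials so that linearity in \<open>v\<close> holds for every
  \<open>u\<close>.\<close>

definition dx :: "real^'n \<Rightarrow> real^'n \<Rightarrow> real^'m" where
  "dx u v = (\<Sum>k\<in>UNIV. v $ k *\<^sub>R partial_deriv k x u)"

text \<open>The form \<open>q\<close> of the overview: the line element at \<open>u\<close>
  evaluated on \<open>v\<close>.\<close>

definition speed2 :: "real^'n \<Rightarrow> real^'n \<Rightarrow> real" where
  "speed2 u v = (norm (dx u v))\<^sup>2"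

abbreviation g :: "'n \<Rightarrow> real^'n \<Rightarrow> real" where
  "g k \<equiv> metric_coeff x k k"

lemma dx_scale: "dx u (c *\<^sub>R v) = c *\<^sub>R dx u v"
  by (simp add: dx_def scaleR_sum_right)

lemma dx_add: "dx u (v + w) = dx u v + dx u w"
  by (simp add: dx_def scaleR_add_left sum.distrib)

lemma dx_diff: "dx u (v - w) = dx u v - dx u w"
  by (simp add: dx_def scaleR_diff_left sum_subtractf)

lemma dx_axis: "dx u (axis k 1) = partial_deriv k x u"
  by (simp add: dx_def axis_def if_distrib[of "\<lambda>c. c *\<^sub>R _"] cong: if_cong)

lemma speed2_scale: "speed2 u (c *\<^sub>R v) = c\<^sup>2 * speed2 u v"
  by (simp add: speed2_def dx_scale power_mult_distrib)

lemma speed2_eq_sum: "speed2 u v = (\<Sum>j\<in>UNIV. \<Sum>k\<in>UNIV. v $ j * v $ k * metric_coeff x j k u)"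
  unfolding speed2_def power2_norm_eq_inner dx_def metric_coeff_def
  by (simp add: inner_sum_left inner_sum_right sum_distrib_left mult.assoc)
     (simp add: inner_commute)

lemma speed2_orthogonal:
  assumes "\<And>j k. j \<noteq> k \<Longrightarrow> metric_coeff x j k u = 0"
  shows "speed2 u v = (\<Sum>k\<in>UNIV. (v $ k)\<^sup>2 * g k u)"
proof -
  have "(\<Sum>k\<in>UNIV. v $ j * v $ k * metric_coeff x j k u) = (v $ j)\<^sup>2 * g j u" for j
    using assms by (subst sum.remove[of _ j]) (auto simp: power2_eq_square)
  then show ?thesis by (simp add: speed2_eq_sum)
qed

lemma continuous_speed2: "continuous_on D (\<lambda>u. speed2 u v)"
  unfolding speed2_def dx_def by (intro continuous_intros continuous_partial)

lemma continuous_speed2_line: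
  assumes "\<And>t. t \<in> T \<Longrightarrow> M + t *\<^sub>R w \<in> D"
  shows "continuous_on T (\<lambda>t. speed2 (M + t *\<^sub>R w) v)"
  by (rule continuous_on_compose2[OF continuous_speed2])
     (use assms in \<open>auto intro!: continuous_intros\<close>)

lemma line_in_n_rectangle:
  assumes "\<bar>t\<bar> \<le> 1" "\<And>k. \<bar>w' $ k\<bar> = \<bar>w $ k\<bar>"
  shows "M + t *\<^sub>R w' \<in> n_rectangle (M - w) (M + w)"
  using assms by (auto simp: n_rectangle_sym_iff abs_mult mult_left_le_one_le)

text \<open>Adding the integrand reflected in \<open>t = 0\<close> doubles the integral and makes
  the integrand even in \<open>t\<close>, the form that \<open>even_eq_0_if_integrals_eq_0\<close>
  requires.\<close>

lemma energy_diagonal: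
  assumes D: "n_rectangle (M - w) (M + w) \<subseteq> D" and \<sigma>: "\<sigma> \<in> sign_vectors"
    and w': "w' = (\<chi> k. \<sigma> $ k * w $ k)"
  shows "2 * energy (x \<circ> diagonal (M - w) (M + w) \<sigma>) (-1) 1
    = integral {-1..1} (\<lambda>t. speed2 (M + t *\<^sub>R w') w' + speed2 (M - t *\<^sub>R w') w')"
proof -
  have diag: "x \<circ> diagonal (M - w) (M + w) \<sigma> = (\<lambda>t. x (M + t *\<^sub>R w'))"
    by (simp add: fun_eq_iff diagonal_def w' Let_def vec_eq_iff flip: scaleR_2)
  have "\<bar>w' $ k\<bar> = \<bar>w $ k\<bar>" for k
  proof -
    have "\<sigma> $ k \<in> {-1, 1}" using \<sigma> by (simp add: sign_vectors_def)
    then show ?thesis by (auto simp: w')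
  qed
  then have in_D: "M + t *\<^sub>R w' \<in> D" if "t \<in> {-1..1}" for t
    using D line_in_n_rectangle[of t w' w M] that by auto
  have "energy (x \<circ> diagonal (M - w) (M + w) \<sigma>) (-1) 1
      = integral {-1..1} (\<lambda>t. speed2 (M + t *\<^sub>R w') w')"
    unfolding energy_def diag
  proof (rule integral_cong)
    fix t :: real assume t: "t \<in> {-1..1}"
    have "vector_derivative (\<lambda>t. x (M + t *\<^sub>R w')) (at t within {-1..1}) = dx (M + t *\<^sub>R w') w'"
      unfolding dx_def using t
      by (intro vector_derivative_at_within_ivl has_vector_derivative_along_line
          differentiable in_D) auto
    then show "(norm (vector_derivative (\<lambda>t. x (M + t *\<^sub>R w')) (at t within {-1..1})))\<^sup>2
        = speed2 (M + t *\<^sub>R w') w'"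
      by (simp add: speed2_def)
  qed
  then show ?thesis
    using integral_symmetric_interval[OF continuous_speed2_line[of "{-1..1}" M w' w', OF in_D]]
    by simp
qed

text \<open>The symmetrised integrand of \<open>energy_diagonal\<close> at \<open>t = 1\<close>,
  that is, at the two vertices which the diagonal joins.\<close>

definition end_speed2 :: "real^'n \<Rightarrow> real^'n \<Rightarrow> real" where
  "end_speed2 M w = speed2 (M + w) w + speed2 (M - w) w"

text \<open>The rectangles shrunk about \<open>M\<close> by factors \<open>s\<close> in
  \<open>(0, 1]\<close> all stay in the box, so their diagonals have equal energies. Up to the
  factor \<open>s^2\<close> these energies are integrals of \<open>H v (s * t)\<close>, and
  \<open>even_eq_0_if_integrals_eq_0\<close> for the difference of the two functions
  \<open>H\<close> gives equality at \<open>t = 1\<close>.\<close>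

lemma equal_energies_imp_equal_end_speed2:
  assumes eq: "equal_diagonal_energies_on D x"
    and B: "box a b \<subseteq> D" "M - w \<in> box a b" "M + w \<in> box a b"
    and w': "\<And>k. \<bar>w' $ k\<bar> = \<bar>w $ k\<bar>"
  shows "end_speed2 M w' = end_speed2 M w"
proof -
  define H where "H v t = speed2 (M + t *\<^sub>R v) v + speed2 (M - t *\<^sub>R v) v" for v t
  have rect: "n_rectangle (M - w) (M + w) \<subseteq> D"
    using n_rectangle_subset_box[OF B(2,3)] B(1) by blast
  have in_D: "M + t *\<^sub>R v \<in> D" if "\<bar>t\<bar> \<le> 1" "\<And>k. \<bar>v $ k\<bar> = \<bar>w $ k\<bar>" for t v
    using line_in_n_rectangle[OF that] rect by blast
  have cont: "continuous_on {-1..1} (H v)" if "\<And>k. \<bar>v $ k\<bar> = \<bar>w $ k\<bar>" for v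
  proof -
    have 1: "continuous_on {-1..1} (\<lambda>t. speed2 (M + t *\<^sub>R v) v)"
      using in_D[OF _ that] by (intro continuous_speed2_line) auto
    have "continuous_on {-1..1} (\<lambda>t. speed2 (M + (- t) *\<^sub>R v) v)"
      by (rule continuous_on_compose2[OF 1]) (auto intro!: continuous_intros)
    with 1 show ?thesis
      unfolding H_def by (intro continuous_on_add) auto
  qed
  \<comment> \<open>Recovers the sign vector that turns \<open>w\<close> into \<open>w'\<close>;
    where \<open>w $ k = 0\<close> either sign would do. The vector \<open>one\<close> stands for
    the unflipped diagonal.\<close>
  define \<sigma> :: "real^'n" where "\<sigma> = (\<chi> k. if w' $ k = w $ k then 1 else -1)"
  define one :: "real^'n" where "one = (\<chi> k. 1)"
  have signs: "\<sigma> \<in> sign_vectors" "one \<in> sign_vectors"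
    by (auto simp: sign_vectors_def \<sigma>_def one_def)
  have \<sigma>w: "(\<chi> k. \<sigma> $ k * w $ k) = w'"
    using w' by (fastforce simp: vec_eq_iff \<sigma>_def abs_eq_iff)
  have "H w' 1 - H w 1 = 0"
  proof (rule even_eq_0_if_integrals_eq_0)
    show "continuous_on {-1..1} (\<lambda>t. H w' t - H w t)"
      using w' by (intro continuous_on_diff cont) auto
    show "H w' (- t) - H w (- t) = H w' t - H w t" for t
      by (simp add: H_def add.commute)
    fix s :: real assume s: "0 < s" "s \<le> 1"
    have mem: "M - s *\<^sub>R w \<in> n_rectangle (M - w) (M + w)" "M + s *\<^sub>R w \<in> n_rectangle (M - w) (M + w)"
      using line_in_n_rectangle[of "-s" w w M] line_in_n_rectangle[of s w w M] s by auto
    have "n_rectangle (M - s *\<^sub>R w) (M + s *\<^sub>R w) \<subseteq> D"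
      using n_rectangle_subset_box[of "M - s *\<^sub>R w" a b "M + s *\<^sub>R w"] mem
        n_rectangle_subset_box[OF B(2,3)] B(1) by blast
    moreover have "M - s *\<^sub>R w \<in> D" "M + s *\<^sub>R w \<in> D"
      using mem rect by auto
    ultimately have "energy (x \<circ> diagonal (M - s *\<^sub>R w) (M + s *\<^sub>R w) \<sigma>) (-1) 1
        = energy (x \<circ> diagonal (M - s *\<^sub>R w) (M + s *\<^sub>R w) one) (-1) 1"
      using eq signs unfolding equal_diagonal_energies_on_def by blast
    \<comment> \<open>\<open>speed2\<close> is quadratic in the direction, which yields
      \<open>s^2\<close>, and the point at parameter \<open>t\<close> of the shrunken diagonal is
      the point at \<open>s * t\<close> of the full one. The factor \<open>s^2\<close> cancels
      afterwards because \<open>s > 0\<close>.\<close>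
    moreover have "2 * energy (x \<circ> diagonal (M - s *\<^sub>R w) (M + s *\<^sub>R w) \<tau>) (-1) 1
        = s\<^sup>2 * integral {-1..1} (\<lambda>t. H v (s * t))"
      if "\<tau> \<in> sign_vectors" "v = (\<chi> k. \<tau> $ k * w $ k)" for \<tau> v
    proof -
      have "s *\<^sub>R v = (\<chi> k. \<tau> $ k * (s *\<^sub>R w) $ k)"
        by (simp add: that(2) vec_eq_iff)
      from energy_diagonal[OF \<open>n_rectangle (M - s *\<^sub>R w) (M + s *\<^sub>R w) \<subseteq> D\<close> that(1) this]
      show ?thesis
        by (simp add: H_def speed2_scale mult.commute[of s] flip: distrib_left)
    qed
    note this[OF signs(1) \<sigma>w[symmetric]] this[OF signs(2), of w]
    ultimately have "integral {-1..1} (\<lambda>t. H w' (s * t)) = integral {-1..1} (\<lambda>t. H w (s * t))"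
      using s by (simp add: one_def)
    moreover have "(\<lambda>t. H v (s * t)) integrable_on {-1..1}" if "\<And>k. \<bar>v $ k\<bar> = \<bar>w $ k\<bar>" for v
    proof (intro integrable_continuous_real continuous_on_compose2[OF cont[OF that]])
      have "\<bar>s * t\<bar> \<le> 1" if "\<bar>t\<bar> \<le> 1" for t
        using that s by (simp add: abs_mult mult_le_one)
      then show "(\<lambda>t. s * t) ` {-1..1} \<subseteq> {-1..1}"
        by (force simp: abs_le_iff)
    qed (auto intro!: continuous_intros)
    ultimately show "integral {-1..1} (\<lambda>t. H w' (s * t) - H w (s * t)) = 0"
      using w' by (simp add: integral_diff)
  qed
  then show ?thesis
    by (simp add: H_def end_speed2_def)
qed

end

section \<open>Separation of variables by integrating the gradient\<close>

text \<open>The segment from a base point \<open>p\<close> to \<open>u\<close> stays in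
  \<open>D\<close> by convexity. In the line integral of the gradient along it, the
  \<open>i\<close>-th summand depends on \<open>u\<close> only through \<open>u $ i\<close>.\<close>

lemma additively_separable_if_partials_depend_on_one_coordinate:
  fixes f :: "real^'n \<Rightarrow> real"
  assumes "convex D"
    and diff: "\<And>u. u \<in> D \<Longrightarrow> f differentiable (at u)"
    and cont: "\<And>i. continuous_on D (partial_deriv i f)"
    and dep: "\<And>i u v. \<lbrakk>u \<in> D; v \<in> D; u $ i = v $ i\<rbrakk> \<Longrightarrow> partial_deriv i f u = partial_deriv i f v"
  obtains U where "\<And>u. u \<in> D \<Longrightarrow> f u = (\<Sum>i\<in>UNIV. U i (u $ i))"
proof (cases "D = {}")
  case False
  then obtain p where p: "p \<in> D" by auto
  \<comment> \<open>Any point of the slice may represent it: by \<open>dep\<close> the partial has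
    the same value at all of them.\<close>
  define \<phi> where "\<phi> i c = partial_deriv i f (SOME u. u \<in> D \<and> u $ i = c)" for i c
  have \<phi>: "partial_deriv i f u = \<phi> i (u $ i)" if "u \<in> D" for i u
  proof -
    have "(SOME v. v \<in> D \<and> v $ i = u $ i) \<in> D \<and> (SOME v. v \<in> D \<and> v $ i = u $ i) $ i = u $ i"
      using that by (rule_tac someI[of _ u]) auto
    then show ?thesis
      unfolding \<phi>_def using that by (intro dep) auto
  qed
  \<comment> \<open>The constant \<open>f p\<close> is spread evenly over the
    \<open>CARD('n)\<close> summands; the integral is the \<open>i\<close>-th component of the line
    integral, with \<open>c\<close> in place of \<open>u $ i\<close>.\<close>
  define U where "U i c = f p / real CARD('n)
      + integral {0..1} (\<lambda>t. (c - p $ i) * \<phi> i (p $ i + t * (c - p $ i)))" for i c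
  have "f u = (\<Sum>i\<in>UNIV. U i (u $ i))" if u: "u \<in> D" for u
  proof -
    define v where "v = u - p"
    have in_D: "p + t *\<^sub>R v \<in> D" if "t \<in> {0..1}" for t
    proof -
      have "p + t *\<^sub>R v = (1 - t) *\<^sub>R p + t *\<^sub>R u"
        by (simp add: v_def algebra_simps)
      then show ?thesis
        using convexD_alt[OF \<open>convex D\<close> p u] that by simp
    qed
    have "((\<lambda>t. \<Sum>i\<in>UNIV. v $ i *\<^sub>R partial_deriv i f (p + t *\<^sub>R v)) has_integral
        f (p + 1 *\<^sub>R v) - f (p + 0 *\<^sub>R v)) {0..1}"
    proof (rule fundamental_theorem_of_calculus)
      fix t :: real assume "t \<in> {0..1}"
      from has_vector_derivative_along_line[OF diff[OF in_D[OF this]]]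
      show "((\<lambda>t. f (p + t *\<^sub>R v)) has_vector_derivative
          (\<Sum>i\<in>UNIV. v $ i *\<^sub>R partial_deriv i f (p + t *\<^sub>R v))) (at t within {0..1})"
        by (rule has_vector_derivative_at_within)
    qed simp
    then have "f u - f p = integral {0..1} (\<lambda>t. \<Sum>i\<in>UNIV. v $ i *\<^sub>R partial_deriv i f (p + t *\<^sub>R v))"
      by (simp add: integral_unique v_def)
    also have "\<dots> = (\<Sum>i\<in>UNIV. integral {0..1} (\<lambda>t. v $ i *\<^sub>R partial_deriv i f (p + t *\<^sub>R v)))"
    proof (intro integral_sum integrable_continuous_real)
      show "continuous_on {0..1} (\<lambda>t. v $ i *\<^sub>R partial_deriv i f (p + t *\<^sub>R v))" for i
        by (intro continuous_on_scaleR continuous_on_const continuous_on_compose2[OF cont])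
           (use in_D in \<open>auto intro!: continuous_intros\<close>)
    qed auto
    also have "\<dots> = (\<Sum>i\<in>UNIV. U i (u $ i) - f p / real CARD('n))"
    proof (intro sum.cong refl)
      fix i
      have "integral {0..1} (\<lambda>t. v $ i *\<^sub>R partial_deriv i f (p + t *\<^sub>R v))
          = integral {0..1} (\<lambda>t. (u $ i - p $ i) * \<phi> i (p $ i + t * (u $ i - p $ i)))"
        using in_D by (intro integral_cong) (simp add: \<phi> v_def)
      then show "integral {0..1} (\<lambda>t. v $ i *\<^sub>R partial_deriv i f (p + t *\<^sub>R v))
          = U i (u $ i) - f p / real CARD('n)"
        by (simp add: U_def)
    qed
    finally show ?thesis
      by (simp add: sum_subtractf)
  qed
  then show thesis by (rule that)
qed (use that in blast)

section \<open>From a Liouville line element to equal energies\<close>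

context C2_map
begin

lemma Liouville_imp_equal_diagonal_energies:
  assumes "orthogonal_Liouville_on D x"
  shows "equal_diagonal_energies_on D x"
proof -
  obtain U where U: "\<And>u j k. \<lbrakk>u \<in> D; j \<noteq> k\<rbrakk> \<Longrightarrow> metric_coeff x j k u = 0"
    "\<And>u k. u \<in> D \<Longrightarrow> g k u = (\<Sum>i\<in>UNIV. U i k (u $ i))"
    using assms unfolding orthogonal_Liouville_on_def by metis
  show ?thesis
    unfolding equal_diagonal_energies_on_def
  proof (intro ballI impI)
    fix P Q \<sigma> \<tau> :: "real^'n" assume "P \<in> D" "Q \<in> D" and rect: "n_rectangle P Q \<subseteq> D"
      and \<sigma>: "\<sigma> \<in> sign_vectors" and \<tau>: "\<tau> \<in> sign_vectors"
    define M w where "M = (1/2) *\<^sub>R (P + Q)" and "w = (1/2) *\<^sub>R (Q - P)"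
    have PQ: "P = M - w" "Q = M + w"
      by (simp_all add: M_def w_def vec_eq_iff field_simps)
    \<comment> \<open>The right-hand side does not mention \<open>\<rho>\<close>, so two instances
      of this formula give the claim.\<close>
    have E: "2 * energy (x \<circ> diagonal P Q \<rho>) (-1) 1 = integral {-1..1} (\<lambda>t. \<Sum>k\<in>UNIV.
        (w $ k)\<^sup>2 * (\<Sum>i\<in>UNIV. U i k (M $ i + t * w $ i) + U i k (M $ i - t * w $ i)))"
      if \<rho>: "\<rho> \<in> sign_vectors" for \<rho>
    proof -
      define w' where "w' = (\<chi> k. \<rho> $ k * w $ k)"
      have w': "w' $ k = w $ k \<or> w' $ k = - w $ k" for k
      proof -
        have "\<rho> $ k \<in> {-1, 1}" using \<rho> by (simp add: sign_vectors_def)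
        then show ?thesis by (auto simp: w'_def)
      qed
      then have abs: "\<bar>w' $ k\<bar> = \<bar>w $ k\<bar>" for k
        by (metis abs_minus_cancel)
      have "2 * energy (x \<circ> diagonal P Q \<rho>) (-1) 1
          = integral {-1..1} (\<lambda>t. speed2 (M + t *\<^sub>R w') w' + speed2 (M - t *\<^sub>R w') w')"
        using rect \<rho> w'_def unfolding PQ by (rule energy_diagonal)
      also have "\<dots> = integral {-1..1} (\<lambda>t. \<Sum>k\<in>UNIV.
        (w $ k)\<^sup>2 * (\<Sum>i\<in>UNIV. U i k (M $ i + t * w $ i) + U i k (M $ i - t * w $ i)))"
      proof (rule integral_cong)
        fix t :: real assume t: "t \<in> {-1..1}"
        have D: "M + t *\<^sub>R w' \<in> D" "M - t *\<^sub>R w' \<in> D"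
          using line_in_n_rectangle[OF _ abs, of t M] line_in_n_rectangle[OF _ abs, of "-t" M]
            t rect unfolding PQ by auto
        have sq: "(w' $ k)\<^sup>2 = (w $ k)\<^sup>2" for k
          using abs by (metis power2_abs)
        have "speed2 (M + t *\<^sub>R w') w' + speed2 (M - t *\<^sub>R w') w'
            = (\<Sum>k\<in>UNIV. (w $ k)\<^sup>2 * g k (M + t *\<^sub>R w')) + (\<Sum>k\<in>UNIV. (w $ k)\<^sup>2 * g k (M - t *\<^sub>R w'))"
          using U(1)[OF D(1)] U(1)[OF D(2)] by (simp add: speed2_orthogonal sq)
        also have "\<dots> = (\<Sum>k\<in>UNIV. (w $ k)\<^sup>2 * (g k (M + t *\<^sub>R w') + g k (M - t *\<^sub>R w')))"
          by (simp only: distrib_left sum.distrib)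
        also have "\<dots> = (\<Sum>k\<in>UNIV. (w $ k)\<^sup>2 *
            (\<Sum>i\<in>UNIV. U i k (M $ i + t * w $ i) + U i k (M $ i - t * w $ i)))"
        proof (intro sum.cong refl arg_cong2[where f = "(*)"])
          fix k
          have "g k (M + t *\<^sub>R w') + g k (M - t *\<^sub>R w')
              = (\<Sum>i\<in>UNIV. U i k (M $ i + t * w' $ i) + U i k (M $ i - t * w' $ i))"
            using D by (simp add: U(2) sum.distrib)
          also have "\<dots> = (\<Sum>i\<in>UNIV. U i k (M $ i + t * w $ i) + U i k (M $ i - t * w $ i))"
          proof (intro sum.cong refl)
            show "U i k (M $ i + t * w' $ i) + U i k (M $ i - t * w' $ i)
                = U i k (M $ i + t * w $ i) + U i k (M $ i - t * w $ i)" for i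
              using w'[of i] by auto
          qed
          finally show "g k (M + t *\<^sub>R w') + g k (M - t *\<^sub>R w')
              = (\<Sum>i\<in>UNIV. U i k (M $ i + t * w $ i) + U i k (M $ i - t * w $ i))" .
        qed
        finally show "speed2 (M + t *\<^sub>R w') w' + speed2 (M - t *\<^sub>R w') w' = (\<Sum>k\<in>UNIV.
            (w $ k)\<^sup>2 * (\<Sum>i\<in>UNIV. U i k (M $ i + t * w $ i) + U i k (M $ i - t * w $ i)))" .
      qed
      finally show ?thesis .
    qed
    from E[OF \<sigma>] E[OF \<tau>]
    show "energy (x \<circ> diagonal P Q \<sigma>) (-1) 1 = energy (x \<circ> diagonal P Q \<tau>) (-1) 1"
      by simp
  qed
qed

section \<open>Orthogonality and regularity of the metric coefficients\<close>

lemma box_around: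
  assumes "u \<in> D"
  obtains a b where "u \<in> box a b" "box a b \<subseteq> D"
proof -
  obtain e where "e > 0" "ball u e \<subseteq> D"
    using open_D assms open_contains_ball by blast
  then show thesis
    using rational_boxes[of e u] that by blast
qed

text \<open>Dividing the vertex identity for \<open>h *\<^sub>R w\<close> and
  \<open>h *\<^sub>R w'\<close> by \<open>h^2\<close> and letting \<open>h\<close> tend to 0 gives
  equal values of \<open>speed2 u\<close> at \<open>w\<close> and \<open>w'\<close>. By polarization
  their difference is \<open>4 * metric_coeff x j k u\<close>.\<close>

lemma equal_diagonal_energies_imp_orthogonal:
  assumes eq: "equal_diagonal_energies_on D x" and "j \<noteq> k" "u \<in> D"
  shows "metric_coeff x j k u = 0"
proof -
  obtain a b where B: "u \<in> box a b" "box a b \<subseteq> D"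
    using box_around \<open>u \<in> D\<close> by blast
  define w w' :: "real^'n" where "w = axis j 1 + axis k 1" and "w' = axis j 1 - axis k 1"
  have abs: "\<bar>(h *\<^sub>R w') $ l\<bar> = \<bar>(h *\<^sub>R w) $ l\<bar>" for h l
    using \<open>j \<noteq> k\<close> by (simp add: w_def w'_def axis_def)
  define F where "F v h = speed2 (u + h *\<^sub>R v) v + speed2 (u - h *\<^sub>R v) v" for v h
  have lim: "(F v \<longlongrightarrow> 2 * speed2 u v) (at_right 0)" for v
  proof -
    have cont: "isCont (\<lambda>u. speed2 u v) u"
      using continuous_speed2 open_D \<open>u \<in> D\<close> continuous_on_eq_continuous_at by blast
    have "((\<lambda>h. u + h *\<^sub>R v) \<longlongrightarrow> u) (at_right 0)" "((\<lambda>h. u - h *\<^sub>R v) \<longlongrightarrow> u) (at_right 0)"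
      by (auto intro!: tendsto_eq_intros)
    then have "(F v \<longlongrightarrow> speed2 u v + speed2 u v) (at_right 0)"
      unfolding F_def by (intro tendsto_add isCont_tendsto_compose[OF cont])
    then show ?thesis by simp
  qed
  have near: "\<forall>\<^sub>F h in at_right 0. u + h *\<^sub>R v \<in> box a b" for v
    by (rule topological_tendstoD[of _ u]) (auto intro!: tendsto_eq_intros B simp: open_box)
  have "\<forall>\<^sub>F h in at_right 0. F w' h = F w h"
    using near[of w] near[of "- w"] eventually_at_right_less[of 0]
  proof eventually_elim
    case (elim h)
    then have "end_speed2 u (h *\<^sub>R w') = end_speed2 u (h *\<^sub>R w)"
      by (intro equal_energies_imp_equal_end_speed2[OF eq B(2)] abs) auto
    then show ?case
      using elim by (simp add: end_speed2_def F_def speed2_scale flip: distrib_left)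
  qed
  then have "(F w \<longlongrightarrow> 2 * speed2 u w') (at_right 0)"
    using lim[of w'] by (simp cong: tendsto_cong)
  then have "speed2 u w' = speed2 u w"
    using lim[of w] tendsto_unique[OF trivial_limit_at_right_real] by fastforce
  then show ?thesis
    by (simp add: w_def w'_def speed2_def dx_add dx_diff dx_axis metric_coeff_def
        power2_norm_eq_inner inner_simps inner_commute)
qed

lemma g_has_derivative:
  assumes "u \<in> D"
  shows "(g k has_derivative (\<lambda>h. 2 * (frechet_derivative (partial_deriv k x) (at u) h \<bullet> partial_deriv k x u))) (at u)"
proof -
  have "(partial_deriv k x has_derivative frechet_derivative (partial_deriv k x) (at u)) (at u)"
    using partial_differentiable[OF assms] frechet_derivative_works by blast
  from has_derivative_inner[OF this this] show ?thesis
    unfolding metric_coeff_def[abs_def] by (simp add: inner_commute)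
qed

lemma g_differentiable: "u \<in> D \<Longrightarrow> g k differentiable (at u)"
  using g_has_derivative differentiable_def by blast

lemma continuous_g: "continuous_on D (g k)"
  by (meson g_differentiable continuous_at_imp_continuous_on differentiable_imp_continuous_within)

text \<open>By the product rule the partial is twice an inner product of a second and a first
  partial of \<open>x\<close>; continuity of the second partials enters here.\<close>

lemma continuous_partial_g: "continuous_on D (partial_deriv i (g k))"
proof -
  have "continuous_on D (\<lambda>u. 2 * (partial_deriv i (partial_deriv k x) u \<bullet> partial_deriv k x u))"
    by (intro continuous_intros continuous_second_partial continuous_partial)
  then show ?thesis
    by (rule continuous_on_eq) (simp add: partial_deriv_eqI[OF g_has_derivative] partial_deriv_def[of i "partial_deriv k x"])
qed

end

section \<open>Mixed second differences vanish on boxes\<close>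

text \<open>A discrete substitute for the mixed second partial, because the metric coefficients of a
  \<open>C^2\<close> map need not have second derivatives. The increments may have either
  sign.\<close>

definition mixed_diff :: "(real^'n \<Rightarrow> real) \<Rightarrow> 'n \<Rightarrow> 'n \<Rightarrow> real \<Rightarrow> real \<Rightarrow> real^'n \<Rightarrow> real" where
  "mixed_diff f i j \<alpha> \<beta> u = f (u + \<alpha> *\<^sub>R axis i 1 + \<beta> *\<^sub>R axis j 1)
     - f (u + \<alpha> *\<^sub>R axis i 1) - f (u + \<beta> *\<^sub>R axis j 1) + f u"

lemma mixed_diff_zero [simp]: "mixed_diff f i j 0 \<beta> u = 0" "mixed_diff f i j \<alpha> 0 u = 0"
  by (simp_all add: mixed_diff_def)

text \<open>Cutting the rectangle at its midline, the values on the midline cancel.\<close>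

lemma mixed_diff_split:
  "mixed_diff f i j \<alpha> \<beta> u
    = mixed_diff f i j (\<alpha>/2) \<beta> u + mixed_diff f i j (\<alpha>/2) \<beta> (u + (\<alpha>/2) *\<^sub>R axis i 1)"
proof -
  have "u + (\<alpha>/2) *\<^sub>R axis i 1 + (\<alpha>/2) *\<^sub>R axis i 1 = u + \<alpha> *\<^sub>R axis i 1"
    by (simp add: vec_eq_iff)
  then show ?thesis
    unfolding mixed_diff_def by (simp only:)
qed

text \<open>As \<open>i \<noteq> j\<close>, every coordinate of the other two corners is a
  coordinate of one of the given corners.\<close>

lemma box_corners:
  fixes u :: "real^'n"
  assumes "i \<noteq> j" "u \<in> box a b" "u + \<alpha> *\<^sub>R axis i 1 + \<beta> *\<^sub>R axis j 1 \<in> box a b"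
  shows "u + \<alpha> *\<^sub>R axis i 1 \<in> box a b" "u + \<beta> *\<^sub>R axis j 1 \<in> box a b"
proof -
  have *: "a $ l < u $ l \<and> u $ l < b $ l"
    "a $ l < (u + \<alpha> *\<^sub>R axis i 1 + \<beta> *\<^sub>R axis j 1) $ l \<and> (u + \<alpha> *\<^sub>R axis i 1 + \<beta> *\<^sub>R axis j 1) $ l < b $ l" for l
    using assms(2,3) unfolding mem_box_cart by blast+
  have "a $ l < (u + \<alpha> *\<^sub>R axis i 1) $ l \<and> (u + \<alpha> *\<^sub>R axis i 1) $ l < b $ l"
    "a $ l < (u + \<beta> *\<^sub>R axis j 1) $ l \<and> (u + \<beta> *\<^sub>R axis j 1) $ l < b $ l" for l
    using *(1)[of l] *(2)[of l] \<open>i \<noteq> j\<close> by (auto simp: axis_def split: if_splits)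
  then show "u + \<alpha> *\<^sub>R axis i 1 \<in> box a b" "u + \<beta> *\<^sub>R axis j 1 \<in> box a b"
    unfolding mem_box_cart by blast+
qed

context C2_map
begin

context
  fixes a b :: "real^'n"
  assumes eq: "equal_diagonal_energies_on D x" and box: "box a b \<subseteq> D"
begin

lemma end_speed2_eq_sum:
  assumes "M + w \<in> D" "M - w \<in> D"
  shows "end_speed2 M w = (\<Sum>l\<in>UNIV. (w $ l)\<^sup>2 * (g l (M + w) + g l (M - w)))"
  using assms equal_diagonal_energies_imp_orthogonal[OF eq]
  by (simp add: end_speed2_def speed2_orthogonal distrib_left sum.distrib)

text \<open>Orthogonality reduces the vertex identity to the diagonal coefficients; their weights
  are squares, so a flip changes only the points of evaluation.\<close>

lemma sum_flip:
  assumes B: "M - w \<in> box a b" "M + w \<in> box a b" and w': "\<And>l. \<bar>w' $ l\<bar> = \<bar>w $ l\<bar>"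
  shows "(\<Sum>l\<in>UNIV. (w $ l)\<^sup>2 * (g l (M + w') + g l (M - w')))
       = (\<Sum>l\<in>UNIV. (w $ l)\<^sup>2 * (g l (M + w) + g l (M - w)))"
proof -
  have "M + w' \<in> D" "M - w' \<in> D"
    using line_in_n_rectangle[OF _ w', of 1 M] line_in_n_rectangle[OF _ w', of "-1" M]
      n_rectangle_subset_box[OF B] box by auto
  moreover have "(w' $ l)\<^sup>2 = (w $ l)\<^sup>2" for l
    using w' by (metis power2_abs)
  ultimately show ?thesis
    using equal_energies_imp_equal_end_speed2[OF eq box B w'] B box
    by (simp add: end_speed2_eq_sum subset_iff)
qed

text \<open>The four corners of the second difference are the vertices
  \<open>M \<plusminus> w\<close> and \<open>M \<plusminus> w'\<close> of a rectangle, degenerate in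
  all directions other than \<open>i\<close> and \<open>j\<close>. Only the coefficients with these
  two indices therefore have nonzero weight.\<close>

lemma mixed_diff_weighted_sum:
  assumes "i \<noteq> j" and B: "u \<in> box a b" "u + \<alpha> *\<^sub>R axis i 1 + \<beta> *\<^sub>R axis j 1 \<in> box a b"
  shows "\<alpha>\<^sup>2 * mixed_diff (g i) i j \<alpha> \<beta> u + \<beta>\<^sup>2 * mixed_diff (g j) i j \<alpha> \<beta> u = 0"
proof -
  define w w' :: "real^'n" where "w = (\<alpha>/2) *\<^sub>R axis i 1 + (\<beta>/2) *\<^sub>R axis j 1"
    and "w' = (\<alpha>/2) *\<^sub>R axis i 1 - (\<beta>/2) *\<^sub>R axis j 1"
  define M where "M = u + w"
  have corners: "M + w = u + \<alpha> *\<^sub>R axis i 1 + \<beta> *\<^sub>R axis j 1" "M - w = u"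
    "M + w' = u + \<alpha> *\<^sub>R axis i 1" "M - w' = u + \<beta> *\<^sub>R axis j 1"
    by (simp_all add: M_def w_def w'_def vec_eq_iff)
  have "\<bar>w' $ l\<bar> = \<bar>w $ l\<bar>" for l
    using \<open>i \<noteq> j\<close> by (simp add: w_def w'_def axis_def)
  from sum_flip[of M w w', OF _ _ this] B
  have "(\<Sum>l\<in>UNIV. (w $ l)\<^sup>2 * mixed_diff (g l) i j \<alpha> \<beta> u) = 0"
    by (simp add: corners mixed_diff_def algebra_simps sum.distrib sum_subtractf)
  also have "(\<Sum>l\<in>UNIV. (w $ l)\<^sup>2 * mixed_diff (g l) i j \<alpha> \<beta> u)
      = (\<Sum>l\<in>{i,j}. (w $ l)\<^sup>2 * mixed_diff (g l) i j \<alpha> \<beta> u)"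
    by (rule sum.mono_neutral_right) (auto simp: w_def axis_def)
  also have "\<dots> = (\<alpha>/2)\<^sup>2 * mixed_diff (g i) i j \<alpha> \<beta> u + (\<beta>/2)\<^sup>2 * mixed_diff (g j) i j \<alpha> \<beta> u"
    using \<open>i \<noteq> j\<close> by (simp add: w_def axis_def)
  finally show ?thesis
    by (simp add: power2_eq_square)
qed

text \<open>The two summands of the previous identity scale differently when \<open>\<alpha>\<close> is halved.\<close>

lemma mixed_diff_in_plane_eq_0:
  assumes "i \<noteq> j" and B: "u \<in> box a b" "u + \<alpha> *\<^sub>R axis i 1 + \<beta> *\<^sub>R axis j 1 \<in> box a b"
  shows "mixed_diff (g i) i j \<alpha> \<beta> u = 0 \<and> mixed_diff (g j) i j \<alpha> \<beta> u = 0"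
proof (cases "\<alpha> = 0 \<or> \<beta> = 0")
  case False
  let ?m = "u + (\<alpha>/2) *\<^sub>R axis i 1"
  have m: "?m + (\<alpha>/2) *\<^sub>R axis i 1 = u + \<alpha> *\<^sub>R axis i 1"
    by (simp add: vec_eq_iff)
  have mid: "u + (\<alpha>/2) *\<^sub>R axis i 1 \<in> box a b" if "u + \<alpha> *\<^sub>R axis i 1 \<in> box a b" "u \<in> box a b" for u
  proof -
    have *: "u + (\<alpha>/2) *\<^sub>R axis i 1 = (1/2) *\<^sub>R u + (1/2) *\<^sub>R (u + \<alpha> *\<^sub>R axis i 1)"
      by (simp add: vec_eq_iff field_simps)
    show ?thesis
      unfolding * by (rule convexD[OF convex_box(2) that(2,1)]) auto
  qed
  have mB: "?m \<in> box a b" "?m + \<beta> *\<^sub>R axis j 1 \<in> box a b"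
    using mid[of u] mid[of "u + \<beta> *\<^sub>R axis j 1"] box_corners[OF assms] B by (simp_all add: algebra_simps)
  define A B where "A = mixed_diff (g i) i j \<alpha> \<beta> u" and "B = mixed_diff (g j) i j \<alpha> \<beta> u"
  have "\<alpha>\<^sup>2 * A + \<beta>\<^sup>2 * B = 0"
    unfolding A_def B_def by (rule mixed_diff_weighted_sum[OF assms])
  \<comment> \<open>The weighted identity holds on each half of the rectangle; the sum of the two
    restores \<open>A\<close> and \<open>B\<close>, with the weight of \<open>A\<close> quartered
    and that of \<open>B\<close> unchanged.\<close>
  moreover have "(\<alpha>/2)\<^sup>2 * A + \<beta>\<^sup>2 * B = 0"
  proof -
    have "(\<alpha>/2)\<^sup>2 * mixed_diff (g i) i j (\<alpha>/2) \<beta> u + \<beta>\<^sup>2 * mixed_diff (g j) i j (\<alpha>/2) \<beta> u = 0"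
      by (intro mixed_diff_weighted_sum \<open>i \<noteq> j\<close> B mB)
    moreover have "(\<alpha>/2)\<^sup>2 * mixed_diff (g i) i j (\<alpha>/2) \<beta> ?m + \<beta>\<^sup>2 * mixed_diff (g j) i j (\<alpha>/2) \<beta> ?m = 0"
      by (intro mixed_diff_weighted_sum \<open>i \<noteq> j\<close> mB) (simp add: m B)
    ultimately show ?thesis
      unfolding A_def B_def mixed_diff_split[of _ i j \<alpha>] by (simp add: distrib_left)
  qed
  then have "\<alpha>\<^sup>2 * A / 4 + \<beta>\<^sup>2 * B = 0"
    by (simp add: power_divide)
  ultimately have "\<alpha>\<^sup>2 * A = 0" "\<beta>\<^sup>2 * B = 0"
    by linarith+
  then have "A = 0" "B = 0"
    using False by auto
  then show ?thesis
    by (simp add: A_def B_def)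
qed auto

text \<open>A three-dimensional rectangle, with half-sides \<open>\<alpha>/2\<close>,
  \<open>\<beta>/2\<close> and \<open>\<gamma>\<close>, brings in the third index. A signed sum over
  its four diagonals produces the second differences on the two faces at
  \<open>\<plusminus>\<gamma>\<close>; those of \<open>g i\<close> and \<open>g j\<close> vanish
  already, which leaves \<open>g k\<close> with weight \<open>\<gamma>^2\<close>.\<close>

lemma mixed_diff_shift_sum:
  assumes ijk: "i \<noteq> j" "k \<noteq> i" "k \<noteq> j" and "\<gamma> \<noteq> 0"
    and B: "\<And>s. \<bar>s\<bar> = \<bar>\<gamma>\<bar> \<Longrightarrow> u + s *\<^sub>R axis k 1 \<in> box a b"
      "\<And>s. \<bar>s\<bar> = \<bar>\<gamma>\<bar> \<Longrightarrow> u + s *\<^sub>R axis k 1 + \<alpha> *\<^sub>R axis i 1 + \<beta> *\<^sub>R axis j 1 \<in> box a b"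
  shows "mixed_diff (g k) i j \<alpha> \<beta> (u + \<gamma> *\<^sub>R axis k 1)
    + mixed_diff (g k) i j \<alpha> \<beta> (u + (- \<gamma>) *\<^sub>R axis k 1) = 0"
proof -
  \<comment> \<open>The sign of the \<open>i\<close>-th component stays fixed, since opposite sign
    vectors give the same diagonal.\<close>
  define w :: "real \<Rightarrow> real \<Rightarrow> real^'n" where "w s t = (\<alpha>/2) *\<^sub>R axis i 1 + (s * (\<beta>/2)) *\<^sub>R axis j 1 + (t * \<gamma>) *\<^sub>R axis k 1" for s t
  define M where "M = u + (\<alpha>/2) *\<^sub>R axis i 1 + (\<beta>/2) *\<^sub>R axis j 1"
  define \<Delta> where "\<Delta> f = mixed_diff f i j \<alpha> \<beta> (u + \<gamma> *\<^sub>R axis k 1)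
    + mixed_diff f i j \<alpha> \<beta> (u + (- \<gamma>) *\<^sub>R axis k 1)" for f
  have corners:
    "M + w 1 t = u + (t * \<gamma>) *\<^sub>R axis k 1 + \<alpha> *\<^sub>R axis i 1 + \<beta> *\<^sub>R axis j 1"
    "M - w 1 t = u + (- (t * \<gamma>)) *\<^sub>R axis k 1"
    "M + w (-1) t = u + (t * \<gamma>) *\<^sub>R axis k 1 + \<alpha> *\<^sub>R axis i 1"
    "M - w (-1) t = u + (- (t * \<gamma>)) *\<^sub>R axis k 1 + \<beta> *\<^sub>R axis j 1" for t
    by (simp_all add: M_def w_def vec_eq_iff)
  have abs: "\<bar>w s t $ l\<bar> = \<bar>w 1 1 $ l\<bar>" if "\<bar>s\<bar> = 1" "\<bar>t\<bar> = 1" for s t l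
    using ijk that by (auto simp: w_def axis_def abs_mult)
  have in_B: "M - w 1 1 \<in> box a b" "M + w 1 1 \<in> box a b"
    unfolding corners by (rule B, simp)+
  define S where "S s t = (\<Sum>l\<in>UNIV. (w 1 1 $ l)\<^sup>2 * (g l (M + w s t) + g l (M - w s t)))" for s t
  have "S s t = S 1 1" if "\<bar>s\<bar> = 1" "\<bar>t\<bar> = 1" for s t
    unfolding S_def by (rule sum_flip[OF in_B abs[OF that]])
  from this[of 1 "-1"] this[of "-1" 1] this[of "-1" "-1"]
  have "S 1 1 + S 1 (-1) - S (-1) 1 - S (-1) (-1) = 0" by simp
  also have "S 1 1 + S 1 (-1) - S (-1) 1 - S (-1) (-1) = (\<Sum>l\<in>UNIV. (w 1 1 $ l)\<^sup>2 * \<Delta> (g l))"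
    unfolding S_def corners \<Delta>_def mixed_diff_def
    by (simp add: algebra_simps flip: sum.distrib sum_subtractf)
  also have "\<dots> = (\<Sum>l\<in>{k}. (w 1 1 $ l)\<^sup>2 * \<Delta> (g l))"
  proof (rule sum.mono_neutral_right)
    have "\<Delta> (g i) = 0" "\<Delta> (g j) = 0"
      using mixed_diff_in_plane_eq_0[OF \<open>i \<noteq> j\<close> B, of \<gamma>]
        mixed_diff_in_plane_eq_0[OF \<open>i \<noteq> j\<close> B, of "- \<gamma>"] by (simp_all add: \<Delta>_def)
    then show "\<forall>l\<in>UNIV - {k}. (w 1 1 $ l)\<^sup>2 * \<Delta> (g l) = 0"
      by (auto simp: w_def axis_def)
  qed auto
  also have "\<dots> = \<gamma>\<^sup>2 * \<Delta> (g k)"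
    using ijk by (simp add: w_def axis_def)
  finally show ?thesis
    using \<open>\<gamma> \<noteq> 0\<close> by (simp add: \<Delta>_def)
qed

text \<open>For a third index \<open>k\<close>, let the two faces of
  \<open>mixed_diff_shift_sum\<close> approach each other. By continuity of \<open>g k\<close> both
  terms tend to the second difference at \<open>u\<close>, so twice its value is 0.\<close>

lemma mixed_diff_eq_0:
  assumes "i \<noteq> j" and B: "u \<in> box a b" "u + \<alpha> *\<^sub>R axis i 1 + \<beta> *\<^sub>R axis j 1 \<in> box a b"
  shows "mixed_diff (g k) i j \<alpha> \<beta> u = 0"
proof (cases "k = i \<or> k = j")
  case True
  then show ?thesis
    using mixed_diff_in_plane_eq_0[OF assms] by auto
next
  case False
  define shift where "shift c v = v + c *\<^sub>R axis k 1" for c and v :: "real^'n"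
  have lim_shift: "((\<lambda>c. shift (s * c) v) \<longlongrightarrow> v) (at_right 0)" for s v
    unfolding shift_def by (auto intro!: tendsto_eq_intros)
  have comm: "shift c u + \<alpha> *\<^sub>R axis i 1 + \<beta> *\<^sub>R axis j 1 = shift c (u + \<alpha> *\<^sub>R axis i 1 + \<beta> *\<^sub>R axis j 1)"
    "shift c u + \<alpha> *\<^sub>R axis i 1 = shift c (u + \<alpha> *\<^sub>R axis i 1)"
    "shift c u + \<beta> *\<^sub>R axis j 1 = shift c (u + \<beta> *\<^sub>R axis j 1)" for c
    by (simp_all add: shift_def)
  have near: "\<forall>\<^sub>F c in at_right 0. shift (s * c) v \<in> box a b" if "v \<in> box a b" for s v
    using topological_tendstoD[OF lim_shift open_box that] .
  have g_lim: "((\<lambda>c. g k (shift (s * c) v)) \<longlongrightarrow> g k v) (at_right 0)" if "v \<in> box a b" for s v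
  proof (rule isCont_tendsto_compose[OF _ lim_shift])
    show "isCont (g k) v"
      using continuous_g open_D box that continuous_on_eq_continuous_at by blast
  qed
  have lim: "((\<lambda>c. mixed_diff (g k) i j \<alpha> \<beta> (shift (s * c) u)) \<longlongrightarrow> mixed_diff (g k) i j \<alpha> \<beta> u) (at_right 0)" for s
    using g_lim[OF B(1), of s] g_lim[OF B(2), of s]
      g_lim[OF box_corners(1)[OF assms], of s] g_lim[OF box_corners(2)[OF assms], of s]
    unfolding mixed_diff_def comm(1) unfolding comm(2,3) by (intro tendsto_intros)
  have "\<forall>\<^sub>F c in at_right 0. mixed_diff (g k) i j \<alpha> \<beta> (shift (1 * c) u)
      + mixed_diff (g k) i j \<alpha> \<beta> (shift ((-1) * c) u) = 0"
    using near[OF B(1), of 1] near[OF B(1), of "-1"] near[OF B(2), of 1] near[OF B(2), of "-1"]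
      eventually_at_right_less[of 0]
  proof eventually_elim
    case (elim c)
    have "u + s *\<^sub>R axis k 1 \<in> box a b"
        "u + s *\<^sub>R axis k 1 + \<alpha> *\<^sub>R axis i 1 + \<beta> *\<^sub>R axis j 1 \<in> box a b" if "\<bar>s\<bar> = \<bar>c\<bar>" for s
    proof -
      have "s = c \<or> s = - c" using that by arith
      then show "u + s *\<^sub>R axis k 1 \<in> box a b"
        "u + s *\<^sub>R axis k 1 + \<alpha> *\<^sub>R axis i 1 + \<beta> *\<^sub>R axis j 1 \<in> box a b"
        using elim by (auto simp: shift_def algebra_simps)
    qed
    then show ?case
      using mixed_diff_shift_sum[OF \<open>i \<noteq> j\<close>, of k c u \<alpha> \<beta>] False elim
      by (simp add: shift_def)
  qed
  then have "((\<lambda>c. mixed_diff (g k) i j \<alpha> \<beta> (shift (1 * c) u)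
      + mixed_diff (g k) i j \<alpha> \<beta> (shift ((-1) * c) u)) \<longlongrightarrow> 0) (at_right 0)"
    by (simp add: tendsto_eventually)
  from tendsto_unique[OF trivial_limit_at_right_real tendsto_add[OF lim lim] this]
  show ?thesis by simp
qed

section \<open>The partials of the diagonal coefficients depend on one coordinate\<close>

text \<open>Vanishing second differences mean that \<open>g k\<close> along two parallel lines in
  direction \<open>i\<close> differs by the constant \<open>?c\<close> near \<open>s = 0\<close>;
  hence the derivatives at 0 agree.\<close>

lemma partial_g_shift:
  assumes "i \<noteq> j" and B: "u \<in> box a b" "u + \<beta> *\<^sub>R axis j 1 \<in> box a b"
  shows "partial_deriv i (g k) (u + \<beta> *\<^sub>R axis j 1) = partial_deriv i (g k) u"
proof -
  have D: "((\<lambda>s. g k (v + s *\<^sub>R axis i 1)) has_vector_derivative partial_deriv i (g k) v) (at 0)"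
    if "v \<in> box a b" for v
    using has_vector_derivative_along_line[of "g k" v 0 "axis i 1"] g_differentiable that box
    by (auto simp: axis_def if_distrib[of "\<lambda>c. c * _"] cong: if_cong)
  let ?c = "g k (u + \<beta> *\<^sub>R axis j 1) - g k u"
  \<comment> \<open>The parameters whose far corner lies in the box, so that
    \<open>mixed_diff_eq_0\<close> applies.\<close>
  define T where "T = (\<lambda>s. u + s *\<^sub>R axis i 1 + \<beta> *\<^sub>R axis j 1) -` box a b"
  have "((\<lambda>s. ?c + g k (u + s *\<^sub>R axis i 1)) has_vector_derivative 0 + partial_deriv i (g k) u) (at 0)"
    by (intro has_vector_derivative_add has_vector_derivative_const D B)
  then have "((\<lambda>s. g k (u + \<beta> *\<^sub>R axis j 1 + s *\<^sub>R axis i 1)) has_vector_derivative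
      0 + partial_deriv i (g k) u) (at 0)"
  proof (rule has_vector_derivative_transform_within_open)
    show "open T"
      unfolding T_def by (intro continuous_open_vimage continuous_intros open_box)
    show "0 \<in> T"
      using B by (simp add: T_def)
    fix s assume "s \<in> T"
    then show "?c + g k (u + s *\<^sub>R axis i 1) = g k (u + \<beta> *\<^sub>R axis j 1 + s *\<^sub>R axis i 1)"
      using mixed_diff_eq_0[OF \<open>i \<noteq> j\<close> B(1), of s \<beta> k] by (simp add: T_def mixed_diff_def add_ac)
  qed
  from vector_derivative_unique_at[OF this D[OF B(2)]] show ?thesis
    by simp
qed

lemma partial_g_eq_in_box:
  assumes B: "u \<in> box a b" "v \<in> box a b" and "u $ i = v $ i"
  shows "partial_deriv i (g k) u = partial_deriv i (g k) v"
proof -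
  \<comment> \<open>Coordinates are switched from \<open>u\<close> to \<open>v\<close> one at a
    time, never the \<open>i\<close>-th; every intermediate point stays in the box.\<close>
  define mix where "mix S = (\<chi> l. if l \<in> S then v $ l else u $ l)" for S
  have mix_B: "mix S \<in> box a b" for S
    using B by (auto simp: mix_def mem_box_cart)
  have "partial_deriv i (g k) (mix S) = partial_deriv i (g k) u" if "finite S" "i \<notin> S" for S
    using that
  proof (induction S)
    case empty
    then show ?case by (simp add: mix_def)
  next
    case (insert j S)
    have "mix (insert j S) = mix S + (v $ j - u $ j) *\<^sub>R axis j 1"
      using insert.hyps by (auto simp: mix_def vec_eq_iff axis_def)
    then show ?case
      using partial_g_shift[of i j "mix S" "v $ j - u $ j" k] mix_B[of S] mix_B[of "insert j S"]
        insert by auto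
  qed
  from this[of "- {i}"] have "partial_deriv i (g k) (mix (- {i})) = partial_deriv i (g k) u"
    by simp
  moreover have "mix (- {i}) = v"
    using \<open>u $ i = v $ i\<close> by (auto simp: mix_def vec_eq_iff)
  ultimately show ?thesis by simp
qed

end

lemma partial_g_eq:
  assumes eq: "equal_diagonal_energies_on D x" and uv: "u \<in> D" "v \<in> D" "u $ i = v $ i"
  shows "partial_deriv i (g k) u = partial_deriv i (g k) v"
proof -
  \<comment> \<open>The slice is convex and hence connected, so agreement of the partial near each
    point propagates over the whole slice.\<close>
  define S where "S = D \<inter> {p. p $ i = u $ i}"
  have "convex {p :: real^'n. p $ i = u $ i}"
    using convex_hyperplane[of "axis i (1::real)" "u $ i"] by (simp add: inner_axis')
  then have "connected S"
    unfolding S_def by (intro convex_connected convex_Int convex_D)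
  then show ?thesis
  proof (rule connected_equivalence_relation[where R = "\<lambda>p q. partial_deriv i (g k) p = partial_deriv i (g k) q"])
    show "u \<in> S" "v \<in> S"
      using uv by (auto simp: S_def)
    fix p assume p: "p \<in> S"
    then obtain a b where ab: "p \<in> box a b" "box a b \<subseteq> D"
      using box_around unfolding S_def by blast
    show "\<exists>T. openin (top_of_set S) T \<and> p \<in> T \<and> (\<forall>q\<in>T. partial_deriv i (g k) p = partial_deriv i (g k) q)"
    proof (intro exI conjI ballI)
      show "openin (top_of_set S) (S \<inter> box a b)"
        by (simp add: openin_open_Int open_box)
      show "p \<in> S \<inter> box a b" using p ab by simp
      show "partial_deriv i (g k) p = partial_deriv i (g k) q" if "q \<in> S \<inter> box a b" for q
        using that p ab by (intro partial_g_eq_in_box[OF eq ab(2)]) (auto simp: S_def)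
    qed
  qed auto
qed

lemma equal_diagonal_energies_imp_Liouville:
  assumes eq: "equal_diagonal_energies_on D x"
  shows "orthogonal_Liouville_on D x"
proof -
  have "\<exists>U. \<forall>u\<in>D. g k u = (\<Sum>i\<in>UNIV. U i (u $ i))" for k
    by (rule additively_separable_if_partials_depend_on_one_coordinate[OF convex_D
          g_differentiable continuous_partial_g partial_g_eq[OF eq]]) blast+
  then obtain U where "\<forall>k. \<forall>u\<in>D. g k u = (\<Sum>i\<in>UNIV. U k i (u $ i))"
    by metis
  \<comment> \<open>The separating functions were obtained separately for each \<open>k\<close>; the
    indices are swapped because the line element puts the coordinate index first.\<close>
  then show ?thesis
    unfolding orthogonal_Liouville_on_def
    using equal_diagonal_energies_imp_orthogonal[OF eq]
    by (intro exI[of _ "\<lambda>i k. U k i"]) auto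
qed

end

theorem theorem6p2:
  fixes D :: "(real^'n) set" and x :: "real^'n \<Rightarrow> real^'m"
  assumes "open D" and "convex D" and "C_k_on 3 x D"
  shows "orthogonal_Liouville_on D x \<longleftrightarrow> equal_diagonal_energies_on D x"
proof -
  \<comment> \<open>Lowers the order of smoothness by one; the base case is continuity of
    differentiable maps.\<close>
  have drop: "C_k_on r f D" if "C_k_on (Suc r) f D" for r and f :: "real^'n \<Rightarrow> real^'m"
    using that
  proof (induction r arbitrary: f)
    case 0
    then show ?case
      by (simp add: continuous_at_imp_continuous_on differentiable_imp_continuous_within)
  qed auto
  interpret C2_map D x
    using assms drop[of 2 x] by unfold_locales simp_all
  show ?thesis
    using Liouville_imp_equal_diagonal_energies equal_diagonal_energies_imp_Liouville by blast
qed

end
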